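(* Let $k\ge 1$ be an integer and let $p$ be a pattern with exactly $k$ distinct variables. (a) If $p$ has length at least $2^k$, then $\lambda(p)\le 3$. (b) If $p$ has length at least $3\times 2^{k-1}$, then $\lambda(p)=2$.
   Context: A pattern is a non-empty finite word over an alphabet $\Delta$ of symbols called variables. A word $x$ over an alphabet $\Sigma$ is an instance of a pattern $p$ if there is a non-erasing morphism $h:\Delta^*\to\Sigma^*$ (i.e. $h(X)$ is a non-empty word for every variable $X$) with $h(p)=x$. An infinite word $w$ over $\Sigma$ avoids $p$ if no factor (contiguous block) of $w$ is an instance of $p$. The avoidability index $\lambda(p)$ is the size of the smallest finite alphabet $\Sigma$ such that some infinite word over $\Sigma$ avoids $p$ ($\lambda(p)=\infty$ if no such finite alphabet exists). The length of $p$ is its number of letters (counted with multiplicity). *)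

theory Defs
  imports "HOL-Library.Extended_Nat" "HOL-Library.Omega_Words_Fun"
begin

text \<open>Finite words are lists; infinite words are functions on \<^typ>\<open>nat\<close>, with
  \<^term>\<open>w [i \<rightarrow> j]\<close> the block of letters at positions \<open>i, \<dots>, j - 1\<close>.\<close>

definition nonerasing_morphism :: "('v list \<Rightarrow> 's list) \<Rightarrow> bool" where
  "nonerasing_morphism h \<longleftrightarrow>
     (\<forall>u v. h (u @ v) = h u @ h v) \<and> (\<forall>X. h [X] \<noteq> [])"

definition is_instance :: "'v list \<Rightarrow> 's list \<Rightarrow> bool" where
  "is_instance p x \<longleftrightarrow> (\<exists>h. nonerasing_morphism h \<and> h p = x)"

definition is_factor :: "'s list \<Rightarrow> 's word \<Rightarrow> bool" where
  "is_factor x w \<longleftrightarrow> (\<exists>i j. x = w [i \<rightarrow> j])"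

definition avoids :: "'s word \<Rightarrow> 'v list \<Rightarrow> bool" where
  "avoids w p \<longleftrightarrow> \<not> (\<exists>x. is_factor x w \<and> is_instance p x)"

text \<open>Only the number of letters of an alphabet matters, so finite alphabets are taken to be
  finite sets of natural numbers. The infimum of the empty set is \<^term>\<open>\<infinity>\<close>.\<close>

definition avoidability_index :: "'v list \<Rightarrow> enat" where
  "avoidability_index p =
     Inf {enat (card \<Sigma>) | \<Sigma> :: nat set.
            finite \<Sigma> \<and> (\<exists>w. range w \<subseteq> \<Sigma> \<and> avoids w p)}"

end

theory Submission
  imports Defs Complex_Main "HOL-Library.FuncSet" "HOL-Library.Sublist"
begin

text \<open>A variable that occurs only once splits the pattern, and the longer part again satisfies the
  length hypothesis with fewer variables; so either at most two variables remain or every variable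
  occurs at least twice.

  If there are at least three variables, each occurring at least twice, count the avoiding words
  of length \<open>n\<close> over \<open>m\<close> letters. A one-letter extension of an avoiding word that is not avoiding ends
  in an instance, which is determined by the images of the variables. Summing over their lengths
  gives a product of geometric series, small enough to yield exponential growth by induction.

  With at most two variables the pattern contains a square (for three letters), or, up to exchanging
  the variables, one of finitely many patterns of length at most 6 built from squares. These are
  avoided by images of ternary square-free words under suitable uniform morphisms: a long square in
  the image desubstitutes to a square in the preimage, and short squares are a finite check.\<close>

section \<open>From finite to infinite words\<close>

text \<open>A morphism is determined by the images of the letters, so \<open>h\<close> is a letter
  map here; \<open>nonerasing_morphism_eq_concat\<close> provides the link to
  \<open>is_instance\<close>.\<close>

definition instance_free :: "'v list \<Rightarrow> 's list \<Rightarrow> bool" where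
  "instance_free p u \<longleftrightarrow> (\<forall>h. (\<forall>X. h X \<noteq> []) \<longrightarrow> \<not> sublist (concat (map h p)) u)"

definition good_words :: "nat \<Rightarrow> 'v list \<Rightarrow> nat \<Rightarrow> nat list set" where
  "good_words m p n = {u. length u = n \<and> set u \<subseteq> {..<m} \<and> instance_free p u}"

definition avoidable_over :: "nat \<Rightarrow> 'v list \<Rightarrow> bool" where
  "avoidable_over m p \<longleftrightarrow> (\<forall>n. good_words m p n \<noteq> {})"

lemma instance_free_sublist: "instance_free p u \<Longrightarrow> sublist v u \<Longrightarrow> instance_free p v"
  unfolding instance_free_def by (meson sublist_order.order_trans)

lemma good_words_sublist:
  "u \<in> good_words m p n \<Longrightarrow> sublist v u \<Longrightarrow> v \<in> good_words m p (length v)"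
  unfolding good_words_def using instance_free_sublist set_mono_sublist by fastforce

lemma nonerasing_morphism_eq_concat:
  assumes "nonerasing_morphism h"
  shows "h u = concat (map (\<lambda>X. h [X]) u)"
proof (induction u)
  case Nil
  have "h ([] @ []) = h [] @ h []"
    using assms unfolding nonerasing_morphism_def by blast
  then show ?case by simp
next
  case (Cons a u)
  have "h ([a] @ u) = h [a] @ h u"
    using assms unfolding nonerasing_morphism_def by blast
  with Cons show ?case by simp
qed

text \<open>Koenig's lemma: a word with good extensions of every length (\<open>ext\<close>) has,
  the alphabet being finite, a one-letter extension with the same property. Iterating from
  \<open>[]\<close> gives an infinite word with only good prefixes.\<close>

lemma infinite_word_of_avoidable_over:
  assumes "avoidable_over m p"
  shows "\<exists>w. range w \<subseteq> {..<m} \<and> avoids w p"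
proof -
  define good where "good u \<longleftrightarrow> set u \<subseteq> {..<m} \<and> instance_free p u" for u :: "nat list"
  have good_sublist: "good v" if "good u" "sublist v u" for u v
    using that instance_free_sublist set_mono_sublist unfolding good_def by blast
  define ext where "ext u \<longleftrightarrow> (\<forall>n. \<exists>v. length v = n \<and> good (u @ v))" for u
  have ext_step: "\<exists>c. ext (u @ [c])" if u: "ext u" for u
  proof (rule ccontr)
    assume "\<nexists>c. ext (u @ [c])"
    then have "\<forall>c. \<exists>n. \<forall>v. length v = n \<longrightarrow> \<not> good (u @ c # v)"
      unfolding ext_def by simp
    then obtain N where N: "\<And>c v. length v = N c \<Longrightarrow> \<not> good (u @ c # v)"
      by metis
    \<comment> \<open>A good extension longer than every \<open>N c\<close> contradicts
      \<open>N\<close> for whichever letter it starts with.\<close>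
    define M where "M = Max (N ` {..<m})"
    obtain v where v: "length v = Suc M" "good (u @ v)"
      using u unfolding ext_def by blast
    then obtain c v' where c: "v = c # v'" by (cases v) auto
    have "c < m" using v c unfolding good_def by auto
    then have le: "N c \<le> length v'" using v c unfolding M_def by auto
    have "sublist (u @ c # take (N c) v') (u @ v)"
      unfolding c sublist_def
      by (rule exI[of _ "[]"], rule exI[of _ "drop (N c) v'"]) simp
    then have "good (u @ c # take (N c) v')" using v good_sublist by blast
    with N[of "take (N c) v'" c] le show False by simp
  qed
  define next_letter where "next_letter u = (SOME c. ext (u @ [c]))" for u
  define s where "s = rec_nat [] (\<lambda>_ u. u @ [next_letter u])"
  have s_simps: "s 0 = []" "s (Suc n) = s n @ [next_letter (s n)]" for n
    by (simp_all add: s_def)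
  have "ext []"
    unfolding ext_def
  proof
    fix n
    obtain v where "v \<in> good_words m p n" using assms unfolding avoidable_over_def by blast
    then show "\<exists>v. length v = n \<and> good ([] @ v)"
      unfolding good_words_def good_def by auto
  qed
  have ext_s: "ext (s n)" for n
  proof (induction n)
    case (Suc n)
    then show ?case using someI_ex[OF ext_step[OF Suc]] by (simp add: s_simps next_letter_def)
  qed (use \<open>ext []\<close> s_simps in simp)
  have good_s: "good (s n)" for n
    using ext_s[of n] good_sublist unfolding ext_def by fastforce
  define w where "w n = next_letter (s n)" for n
  have s_eq: "s n = map w [0..<n]" for n
    by (induction n) (simp_all add: s_simps w_def)
  have "w n < m" for n
    using good_s[of "Suc n"] unfolding good_def s_eq by auto
  moreover have "avoids w p"
    unfolding avoids_def
  proof (rule notI, elim exE conjE)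
    fix x assume x: "is_factor x w" "is_instance p x"
    obtain i j where ij: "x = map w [i..<j]"
      using x(1) unfolding is_factor_def subsequence_def by blast
    obtain h where h: "nonerasing_morphism h" "h p = x"
      using x(2) unfolding is_instance_def by blast
    have "map w [0..<max i j] = map w [0..<i] @ map w [i..<max i j]"
      by (metis le_add_diff_inverse map_append max.cobounded1 upt_add_eq_append zero_le)
    \<comment> \<open>A block with \<open>j < i\<close> is empty; \<open>max i j\<close> covers this
      case as well.\<close>
    moreover have "map w [i..<max i j] = x"
      unfolding ij by (cases "i \<le> j") (auto simp: max_def)
    ultimately have "sublist x (s (max i j))"
      unfolding s_eq sublist_def by (metis append_Nil2)
    moreover have "x = concat (map (\<lambda>X. h [X]) p)"
      using h nonerasing_morphism_eq_concat by metis
    moreover have "\<forall>X. h [X] \<noteq> []" using h unfolding nonerasing_morphism_def by blast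
    ultimately show False
      using good_s[of "max i j"] unfolding good_def instance_free_def
      by (elim conjE allE[of _ "\<lambda>X. h [X]"]) simp
  qed
  ultimately show ?thesis by auto
qed

lemma avoidability_index_le:
  assumes "avoidable_over m p"
  shows "avoidability_index p \<le> enat m"
proof -
  obtain w :: "nat word" where "range w \<subseteq> {..<m}" "avoids w p"
    using infinite_word_of_avoidable_over[OF assms] by blast
  then show ?thesis
    unfolding avoidability_index_def by (intro Inf_lower) (force intro!: exI[of _ "{..<m}"])
qed

text \<open>Over fewer than two letters a word is constant, and sending every variable to its letter
  makes a prefix an instance of \<open>p\<close>.\<close>

lemma avoidability_index_ge_2: "2 \<le> avoidability_index p"
  unfolding avoidability_index_def
proof (rule Inf_greatest)
  fix e
  assume "e \<in> {enat (card \<Sigma>) | \<Sigma> :: nat set. finite \<Sigma> \<and> (\<exists>w. range w \<subseteq> \<Sigma> \<and> avoids w p)}"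
  then obtain \<Sigma> :: "nat set" and w where e: "e = enat (card \<Sigma>)" "finite \<Sigma>"
      and w: "range w \<subseteq> \<Sigma>" "avoids w p" by blast
  have "2 \<le> card \<Sigma>"
  proof (rule ccontr)
    assume "\<not> 2 \<le> card \<Sigma>"
    then have const: "w i = w 0" for i
      using w(1) card_le_Suc0_iff_eq[OF e(2)] by (metis One_nat_def Suc_1 not_less_eq_eq rangeI subsetD)
    define h where "h u = replicate (length u) (w 0)" for u :: "'a list"
    have "nonerasing_morphism h"
      unfolding nonerasing_morphism_def h_def by (simp add: replicate_add)
    moreover have "h p = (w [0 \<rightarrow> length p])"
      unfolding h_def subsequence_def by (rule nth_equalityI) (simp, simp, metis const)
    ultimately show False
      using w(2) unfolding avoids_def is_factor_def is_instance_def by blast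
  qed
  then show "2 \<le> e" using e by (simp add: numeral_eq_enat)
qed

text \<open>An instance of \<open>p\<close> contains one of \<open>q\<close>, and composing with the
  inverse renaming makes it an instance of \<open>map \<phi> q\<close>. This allows two-variable
  patterns to be studied over \<open>bool\<close>.\<close>

lemma avoidable_over_map_sublist:
  assumes "avoidable_over m (map \<phi> q)" "sublist q p" "inj_on \<phi> (set q)"
  shows "avoidable_over m p"
proof -
  have "instance_free p u" if "instance_free (map \<phi> q) u" for u :: "nat list"
    unfolding instance_free_def
  proof (intro allI impI notI)
    fix h :: "'b \<Rightarrow> nat list" assume h: "\<forall>X. h X \<noteq> []" "sublist (concat (map h p)) u"
    define g where "g = h \<circ> inv_into (set q) \<phi>"
    have "concat (map g (map \<phi> q)) = concat (map h q)"
      unfolding g_def using assms(3) by (intro arg_cong[of _ _ concat]) simp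
    moreover have "sublist (concat (map h q)) (concat (map h p))"
      using assms(2) unfolding sublist_def by (metis concat_append map_append)
    moreover have "\<forall>X. g X \<noteq> []" using h unfolding g_def by simp
    ultimately show False
      using that h(2) unfolding instance_free_def by (metis sublist_order.order_trans)
  qed
  then show ?thesis
    using assms(1) unfolding avoidable_over_def good_words_def by blast
qed

lemma avoidable_over_sublist:
  "avoidable_over m q \<Longrightarrow> sublist q p \<Longrightarrow> avoidable_over m p"
  using avoidable_over_map_sublist[of m id q p] by simp

section \<open>Counting avoiding words\<close>

lemma length_concat_map_eq_sum:
  "length (concat (map h p)) = (\<Sum>X\<in>set p. count_list p X * length (h X))"
  by (simp add: length_concat comp_def sum_list_map_eq_sum_count)

lemma finite_good_words: "finite (good_words m p n)"
proof (rule finite_subset)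
  show "good_words m p n \<subseteq> {u. set u \<subseteq> {..<m} \<and> length u = n}"
    unfolding good_words_def by auto
qed (rule finite_lists_length_eq, simp)

text \<open>A failing extension is determined by the good prefix \<open>v\<close> before the
  instance at its end and by the images of the variables. A length profile \<open>l\<close> leaves
  \<open>m ^ l X\<close> candidates for the image of each \<open>X\<close>.\<close>

lemma card_bad_extensions_le:
  fixes p :: "'v list" and m n :: nat
  defines "L \<equiv> \<lambda>l. \<Sum>X\<in>set p. count_list p X * l X"
  defines "E \<equiv> {l \<in> set p \<rightarrow>\<^sub>E {1..Suc n}. L l \<le> Suc n}"
  assumes "p \<noteq> []"
  shows "m * card (good_words m p n) \<le>
    card (good_words m p (Suc n)) +
    (\<Sum>l\<in>E. card (good_words m p (Suc n - L l)) * (\<Prod>X\<in>set p. m ^ l X))"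
proof -
  define B where
    "B = (\<lambda>(u, c). u @ [c]) ` (good_words m p n \<times> {..<m}) - good_words m p (Suc n)"
  define W where "W i = {u :: nat list. set u \<subseteq> {..<m} \<and> length u = i}" for i
  have finW: "finite (W i)" and cardW: "card (W i) = m ^ i" for i
    unfolding W_def using finite_lists_length_eq[of "{..<m}" i] card_lists_length_eq[of "{..<m}" i]
    by simp_all
  define C where "C l = good_words m p (Suc n - L l) \<times> (PiE (set p) (\<lambda>X. W (l X)))" for l
  have finE: "finite E" unfolding E_def by (simp add: finite_PiE)
  have finC: "finite (C l)" for l
    unfolding C_def using finW by (intro finite_cartesian_product finite_good_words finite_PiE) auto
  have sub: "B \<subseteq> (\<Union>l\<in>E. (\<lambda>(v, h). v @ concat (map h p)) ` C l)"
  proof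
    fix z assume "z \<in> B"
    then obtain u c where z: "z = u @ [c]" and u: "u \<in> good_words m p n" and c: "c < m"
      and bad: "z \<notin> good_words m p (Suc n)" unfolding B_def by auto
    have lz: "length z = Suc n" "set z \<subseteq> {..<m}" using z u c unfolding good_words_def by auto
    then obtain h :: "'v \<Rightarrow> nat list" where h: "\<forall>X. h X \<noteq> []" "sublist (concat (map h p)) z"
      using bad unfolding good_words_def instance_free_def by auto
    obtain v y where vy: "z = v @ concat (map h p) @ y" using h(2) unfolding sublist_def by blast
    \<comment> \<open>Otherwise the instance would already lie in \<open>u\<close>.\<close>
    have "y = []"
    proof (rule ccontr)
      assume "y \<noteq> []"
      then have "u = v @ concat (map h p) @ butlast y"
        using vy z by (metis append.assoc append_butlast_last_id append_same_eq butlast_append butlast_snoc)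
      then show False using u h(1) unfolding good_words_def instance_free_def sublist_def by blast
    qed
    define l where "l = restrict (\<lambda>X. length (h X)) (set p)"
    have Ll: "L l = length (concat (map h p))"
      unfolding L_def length_concat_map_eq_sum l_def by (intro sum.cong) auto
    have len: "length v + L l = Suc n" using vy lz \<open>y = []\<close> Ll by simp
    have hne: "concat (map h p) \<noteq> []" using h(1) \<open>p \<noteq> []\<close> by (cases p) auto
    have hX: "length (h X) \<le> Suc n" "set (h X) \<subseteq> {..<m}" if "X \<in> set p" for X
    proof -
      have "sublist (h X) (concat (map h p))"
        using that unfolding sublist_def by (metis concat.simps(2) concat_append list.simps(9) map_append split_list)
      then have "sublist (h X) z" using h(2) by (metis sublist_order.order_trans)
      then show "length (h X) \<le> Suc n" "set (h X) \<subseteq> {..<m}"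
        using lz set_mono_sublist sublist_length_le by (metis, blast)
    qed
    have "l \<in> E"
      unfolding E_def using len h(1) hX by (auto simp: l_def Suc_le_eq)
    moreover have "sublist v u"
    proof -
      have "u = v @ butlast (concat (map h p))"
        using vy z \<open>y = []\<close> hne by (metis append.right_neutral butlast_append butlast_snoc)
      then show ?thesis by simp
    qed
    then have "v \<in> good_words m p (Suc n - L l)"
      using good_words_sublist[OF u, of v] len by (metis add_diff_cancel_right')
    then have "(v, restrict h (set p)) \<in> C l"
      unfolding C_def using hX by (auto simp: W_def l_def)
    moreover have "z = v @ concat (map (restrict h (set p)) p)"
      using vy \<open>y = []\<close> by (simp add: map_idI cong: map_cong)
    ultimately show "z \<in> (\<Union>l\<in>E. (\<lambda>(v, h). v @ concat (map h p)) ` C l)"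
      by (force)
  qed
  have finB: "finite B" unfolding B_def by (simp add: finite_good_words)
  have "card B \<le> (\<Sum>l\<in>E. card ((\<lambda>(v, h). v @ concat (map h p)) ` C l))"
    using card_mono[OF _ sub] finE finC
    by (intro order_trans[OF card_mono[OF _ sub] card_UN_le[OF finE]]) auto
  also have "\<dots> \<le> (\<Sum>l\<in>E. card (C l))"
    by (intro sum_mono card_image_le finC)
  also have "\<dots> = (\<Sum>l\<in>E. card (good_words m p (Suc n - L l)) * (\<Prod>X\<in>set p. m ^ l X))"
    unfolding C_def by (simp add: card_cartesian_product card_PiE cardW)
  finally have B: "card B \<le> \<dots>" .
  have "m * card (good_words m p n) = card ((\<lambda>(u, c). u @ [c]) ` (good_words m p n \<times> {..<m}))"
    by (subst card_image) (auto simp: inj_on_def card_cartesian_product)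
  also have "\<dots> \<le> card (good_words m p (Suc n) \<union> B)"
    using finB by (intro card_mono) (auto simp: B_def finite_good_words)
  also have "\<dots> \<le> card (good_words m p (Suc n)) + card B" by (rule card_Un_le)
  finally show ?thesis using B by linarith
qed

text \<open>Replacing \<open>z\<close> by \<open>t\<close> in the denominator only keeps the
  numerator exact and gives all variables a common denominator in the counting argument.\<close>

lemma sum_powers_le:
  fixes z t :: real
  assumes "0 \<le> z" "z \<le> t" "t < 1"
  shows "(\<Sum>i=1..N. z ^ i) \<le> z / (1 - t)"
proof -
  have "(\<Sum>i=1..N. z ^ i) \<le> z / (1 - z)"
  proof (induction N)
    case 0
    then show ?case using assms by simp
  next
    case (Suc N)
    have "(\<Sum>i=1..Suc N. z ^ i) = z + z * (\<Sum>i=1..N. z ^ i)"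
      by (subst sum.atLeast_Suc_atMost) (simp_all add: sum_distrib_left sum.shift_bounds_cl_Suc_ivl del: sum.cl_ivl_Suc)
    also have "\<dots> \<le> z + z * (z / (1 - z))"
      using Suc assms by (intro add_left_mono mult_left_mono) auto
    also have "\<dots> = z / (1 - z)" using assms by (simp add: field_simps)
    finally show ?case .
  qed
  also have "\<dots> \<le> z / (1 - t)" using assms by (intro divide_left_mono) auto
  finally show ?thesis .
qed

text \<open>By induction the counts grow by a factor of at least \<open>1 / x\<close> per letter.
  After multiplication by \<open>x\<close>, the failing extensions amount to at most
  \<open>(m * x - 1) * a n\<close> by \<open>bound\<close>, which leaves
  \<open>a n \<le> x * a (Suc n)\<close>.\<close>

lemma avoidable_over_by_counting:
  fixes p :: "'v list" and x :: real
  assumes p: "p \<noteq> []" and doubled: "\<forall>X\<in>set p. 2 \<le> count_list p X"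
    and x: "0 < x" "x \<le> 1" "m * x\<^sup>2 < 1"
    and bound: "(m / (1 - m * x\<^sup>2)) ^ card (set p) * x ^ length p \<le> m * x - 1"
  shows "avoidable_over m p"
proof -
  define a where "a n = real (card (good_words m p n))" for n
  define L where "L l = (\<Sum>X\<in>set p. count_list p X * l X)" for l :: "'v \<Rightarrow> nat"
  define E where "E n = {l \<in> set p \<rightarrow>\<^sub>E {1..Suc n}. L l \<le> Suc n}" for n
  have a_nonneg: "0 \<le> a n" for n by (simp add: a_def)
  have lenp: "length p = (\<Sum>X\<in>set p. count_list p X)" by (simp add: sum_count_set)
  have step: "a n \<le> x * a (Suc n)" for n
  proof (induction n rule: less_induct)
    case (less n)
    \<comment> \<open>The induction hypothesis, iterated backwards from \<open>n\<close>.\<close>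
    have earlier: "a (n - i) \<le> x ^ i * a n" if "i \<le> n" for i
      using that
    proof (induction i)
      case (Suc i)
      have "a (n - Suc i) \<le> x * a (Suc (n - Suc i))"
        using less Suc.prems by simp
      also have "Suc (n - Suc i) = n - i" using Suc.prems by simp
      also have "x * a (n - i) \<le> x * (x ^ i * a n)"
        using Suc x by (intro mult_left_mono) auto
      finally show ?case by (simp add: mult_ac)
    qed simp
    have term_le: "x * (a (Suc n - L l) * (\<Prod>X\<in>set p. real m ^ l X))
        \<le> a n * (\<Prod>X\<in>set p. (m * x ^ count_list p X) ^ l X)" if l: "l \<in> E n" for l
    proof -
      obtain X where X: "X \<in> set p" using p by (meson last_in_set)
      have "1 \<le> l X" "2 \<le> count_list p X" using l X doubled unfolding E_def by auto
      then have "1 \<le> count_list p X * l X" by simp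
      also have "\<dots> \<le> L l" unfolding L_def using X by (intro member_le_sum) auto
      finally have "1 \<le> L l" .
      moreover have "L l \<le> Suc n" using l unfolding E_def by simp
      ultimately have "x * a (Suc n - L l) \<le> x * (x ^ (L l - 1) * a n)"
        using earlier[of "L l - 1"] x by (intro mult_left_mono) auto
      also have "\<dots> = x ^ L l * a n"
        using \<open>1 \<le> L l\<close> by (metis One_nat_def Suc_le_D diff_Suc_1 mult.assoc power_Suc)
      finally have "x * (a (Suc n - L l) * (\<Prod>X\<in>set p. real m ^ l X))
          \<le> x ^ L l * a n * (\<Prod>X\<in>set p. real m ^ l X)"
        unfolding mult.assoc[symmetric] by (intro mult_right_mono prod_nonneg) auto
      also have "x ^ L l = (\<Prod>X\<in>set p. (x ^ count_list p X) ^ l X)"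
        unfolding L_def by (simp add: power_sum power_mult)
      finally show ?thesis by (simp add: power_mult_distrib prod.distrib mult_ac)
    qed
    have "real m * a n \<le> a (Suc n) +
        (\<Sum>l\<in>E n. a (Suc n - L l) * (\<Prod>X\<in>set p. real m ^ l X))"
      using card_bad_extensions_le[OF p, of m n, folded L_def, folded E_def]
      unfolding a_def by (simp flip: of_nat_mult of_nat_add of_nat_sum of_nat_prod of_nat_power)
    then have "x * (real m * a n) \<le> x * (a (Suc n) +
        (\<Sum>l\<in>E n. a (Suc n - L l) * (\<Prod>X\<in>set p. real m ^ l X)))"
      using x by (intro mult_left_mono) auto
    also have "\<dots> = x * a (Suc n) +
        (\<Sum>l\<in>E n. x * (a (Suc n - L l) * (\<Prod>X\<in>set p. real m ^ l X)))"
      by (simp add: distrib_left sum_distrib_left)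
    also have "\<dots> \<le> x * a (Suc n) +
        (\<Sum>l\<in>E n. a n * (\<Prod>X\<in>set p. (m * x ^ count_list p X) ^ l X))"
      by (intro add_left_mono sum_mono term_le)
    \<comment> \<open>Without the constraint on \<open>L l\<close> the profiles form a full product,
      so the sum factors into one geometric series per variable. As each variable occurs twice,
      every ratio is at most \<open>m * x\<^sup>2 < 1\<close>.\<close>
    also have "(\<Sum>l\<in>E n. a n * (\<Prod>X\<in>set p. (m * x ^ count_list p X) ^ l X)) \<le>
        (\<Sum>l\<in>set p \<rightarrow>\<^sub>E {1..Suc n}. a n * (\<Prod>X\<in>set p. (m * x ^ count_list p X) ^ l X))"
      using x a_nonneg unfolding E_def
      by (intro sum_mono2) (auto intro!: finite_PiE mult_nonneg_nonneg prod_nonneg)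
    also have "\<dots> = a n * (\<Prod>X\<in>set p. \<Sum>i=1..Suc n. (m * x ^ count_list p X) ^ i)"
      by (subst prod_sum_PiE) (simp_all add: sum_distrib_left)
    also have "\<dots> \<le> a n * (\<Prod>X\<in>set p. m * x ^ count_list p X / (1 - m * x\<^sup>2))"
    proof (intro mult_left_mono prod_mono conjI a_nonneg)
      fix X assume "X \<in> set p"
      then have "x ^ count_list p X \<le> x\<^sup>2" using doubled x by (intro power_decreasing) auto
      then have "m * x ^ count_list p X \<le> m * x\<^sup>2" by (intro mult_left_mono) auto
      then show "(\<Sum>i=1..Suc n. (m * x ^ count_list p X) ^ i) \<le> m * x ^ count_list p X / (1 - m * x\<^sup>2)"
        using x by (intro sum_powers_le) auto
    qed (use x in \<open>intro sum_nonneg zero_le_power mult_nonneg_nonneg, auto\<close>)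
    also have "(\<Prod>X\<in>set p. m * x ^ count_list p X / (1 - m * x\<^sup>2)) =
        (m / (1 - m * x\<^sup>2)) ^ card (set p) * x ^ length p"
      unfolding lenp by (simp add: prod.distrib prod_dividef power_sum power_divide)
    also have "a n * \<dots> \<le> a n * (m * x - 1)" using bound a_nonneg by (intro mult_left_mono)
    finally show ?case by (simp add: algebra_simps)
  qed
  have "[] \<in> good_words m p 0"
    unfolding good_words_def instance_free_def using p by (cases p) auto
  then have "0 < a 0" unfolding a_def by (auto simp: card_gt_0_iff finite_good_words)
  have "0 < a n" for n
  proof (induction n)
    case (Suc n)
    then have "0 < x * a (Suc n)" using step[of n] by linarith
    then show ?case using x by (simp add: zero_less_mult_iff)
  qed (fact \<open>0 < a 0\<close>)
  then show ?thesis unfolding avoidable_over_def a_def by (metis card.empty less_irrefl of_nat_0)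
qed

text \<open>An additional variable costs a factor \<open>C\<close>, but the doubled exponent gains
  at least \<open>x ^ c\<close>, and \<open>C * x ^ c \<le> 1\<close>. So the estimate for three
  variables persists.\<close>

lemma doubled_bound:
  fixes C x :: real
  assumes "1 \<le> C" "0 < x" "x \<le> 1" and base: "C ^ 3 * x ^ c \<le> b" and step: "C * x ^ c \<le> 1"
    and "3 \<le> k" and "c * 2 ^ (k - 3) \<le> n"
  shows "C ^ k * x ^ n \<le> b"
proof -
  have bound: "C ^ (3 + j) * x ^ (c * 2 ^ j) \<le> b" for j
  proof (induction j)
    case 0
    then show ?case using base by simp
  next
    case (Suc j)
    have "x ^ (c * 2 ^ j) \<le> x ^ c" using assms by (intro power_decreasing) auto
    then have "C * x ^ (c * 2 ^ j) \<le> 1"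
      using assms mult_left_mono[of "x ^ (c * 2 ^ j)" "x ^ c" C] by linarith
    then have "(C ^ (3 + j) * x ^ (c * 2 ^ j)) * (C * x ^ (c * 2 ^ j)) \<le> (C ^ (3 + j) * x ^ (c * 2 ^ j)) * 1"
      using assms by (intro mult_left_mono) auto
    moreover have "x ^ (c * 2 ^ Suc j) = x ^ (c * 2 ^ j) * x ^ (c * 2 ^ j)"
      by (simp add: mult_2 distrib_left flip: power_add)
    moreover have "C ^ (3 + Suc j) = C * C ^ (3 + j)" by (simp only: add_Suc_right power_Suc)
    ultimately have "C ^ (3 + Suc j) * x ^ (c * 2 ^ Suc j) \<le> C ^ (3 + j) * x ^ (c * 2 ^ j)"
      by (simp only: mult_ac mult_1_right)
    then show ?case using Suc by linarith
  qed
  have "C ^ k * x ^ n \<le> C ^ k * x ^ (c * 2 ^ (k - 3))"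
    using assms by (intro mult_left_mono power_decreasing) auto
  also have "\<dots> \<le> b" using bound[of "k - 3"] \<open>3 \<le> k\<close> by simp
  finally show ?thesis .
qed

section \<open>Squares in images of square-free words\<close>

text \<open>The bound is on the root of a square, so \<open>squares_le 0\<close> is
  square-freeness.\<close>

definition squares_le :: "nat \<Rightarrow> 's list \<Rightarrow> bool" where
  "squares_le N s \<longleftrightarrow> (\<forall>u. sublist (u @ u) s \<longrightarrow> length u \<le> N)"

text \<open>\<open>c\<close> is the number of agreements still allowed in the current run; a
  mismatch restores it to \<open>r\<close>.\<close>

fun common_run_le :: "nat \<Rightarrow> nat \<Rightarrow> 'a list \<Rightarrow> 'a list \<Rightarrow> bool" where
  "common_run_le r c (x # xs) (y # ys) =
     (if x = y then (case c of 0 \<Rightarrow> False | Suc c' \<Rightarrow> common_run_le r c' xs ys)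
      else common_run_le r r xs ys)"
| "common_run_le r c _ _ = True"

text \<open>A square with root length \<open>d\<close> is a run of \<open>d\<close> agreements
  between a word and its shift by \<open>d\<close>. The third argument is meant to be
  \<open>s\<close> shifted by \<open>Suc N\<close>, hence the allowance \<open>N\<close>, which
  grows with the shift.\<close>

fun shifts_run_le :: "nat \<Rightarrow> 'a list \<Rightarrow> 'a list \<Rightarrow> bool" where
  "shifts_run_le N s [] = True"
| "shifts_run_le N s (y # t) = (common_run_le N N s (y # t) \<and> shifts_run_le (Suc N) s t)"

text \<open>Comparing \<open>s\<close> with each of its shifts makes the test quadratic in the length of \<open>s\<close>.\<close>
definition no_square_above :: "nat \<Rightarrow> 'a list \<Rightarrow> bool" where
  "no_square_above N s = shifts_run_le N s (drop (Suc N) s)"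

lemma common_run_le_prefix:
  assumes "common_run_le r c (v @ xs) (v @ ys)"
  shows "length v \<le> c"
  using assms
proof (induction v arbitrary: c)
  case (Cons a v)
  then show ?case by (cases c) auto
qed simp

lemma common_run_leD:
  assumes "common_run_le r c (xs @ v @ xs') (ys @ v @ ys')" "c \<le> r" "length xs = length ys"
  shows "length v \<le> r"
  using assms
proof (induction xs arbitrary: c ys)
  case Nil
  then show ?case using common_run_le_prefix[of r c v] by fastforce
next
  case (Cons a xs)
  then obtain b ys2 where "ys = b # ys2" by (cases ys) auto
  with Cons show ?case by (cases c) (fastforce split: if_splits)+
qed

lemma shifts_run_leD:
  assumes "shifts_run_le N s t"
  shows "common_run_le (N + j) (N + j) s (drop j t)"
  using assms
proof (induction t arbitrary: N j)
  case (Cons y t)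
  show ?case
  proof (cases j)
    case (Suc i)
    then show ?thesis using Cons.IH[of "Suc N" i] Cons.prems by simp
  qed (use Cons.prems in simp)
qed (cases s; simp)

lemma squares_leI:
  assumes "no_square_above N s"
  shows "squares_le N s"
  unfolding squares_le_def
proof (intro allI impI, rule ccontr)
  fix u assume u: "sublist (u @ u) s" "\<not> length u \<le> N"
  then obtain x z where s: "s = x @ u @ u @ z" unfolding sublist_def by auto
  \<comment> \<open>The shift by \<open>Suc r\<close> is tested with allowance \<open>r\<close>, one
    less than a square would need.\<close>
  define r where "r = length u - 1"
  have r: "N + (r - N) = r" "r - N + Suc N = length u" using u(2) unfolding r_def by simp_all
  have "common_run_le r r s (drop (length u) s)"
    using shifts_run_leD[of N s "drop (Suc N) s" "r - N"] assms r unfolding no_square_above_def by simp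
  moreover have "drop (length u) s = drop (length u) (x @ u) @ u @ z"
    unfolding s by simp
  ultimately have "common_run_le r r (x @ u @ u @ z) (drop (length u) (x @ u) @ u @ z)"
    using s by metis
  then have "length u \<le> r" by (rule common_run_leD) simp_all
  then show False using u(2) unfolding r_def by simp
qed

lemma squares_le_sublist: "squares_le N s \<Longrightarrow> sublist t s \<Longrightarrow> squares_le N t"
  unfolding squares_le_def by (meson sublist_order.order_trans)

lemma squares_le_0D:
  assumes "squares_le 0 w" "0 < n" "s + 2 * n \<le> length w"
  shows "\<exists>j. s \<le> j \<and> j < s + n \<and> w ! j \<noteq> w ! (j + n)"
proof (rule ccontr)
  assume "\<not> ?thesis"
  then have eq: "w ! j = w ! (j + n)" if "s \<le> j" "j < s + n" for j using that by blast
  let ?t = "take n (drop s w)"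
  have "?t = take n (drop (s + n) w)"
    using assms eq by (intro nth_equalityI) (simp_all add: add_ac)
  then have "w = take s w @ ?t @ ?t @ drop (s + 2 * n) w"
    by (metis add.commute append_take_drop_id drop_drop mult_2)
  then have "sublist (?t @ ?t) w" unfolding sublist_def by (metis append.assoc)
  then show False using assms unfolding squares_le_def by fastforce
qed

section \<open>Uniform synchronizing morphisms\<close>

text \<open>The letters of the preimage are \<open>0, 1, 2\<close>. By \<open>sync\<close> a block occurs in the image of a
  square-free word only at multiples of \<open>q\<close>; by \<open>border\<close> a long square in the image can be moved to
  block boundaries, to the left or to the right.\<close>
locale sync_morphism =
  fixes f :: "nat \<Rightarrow> nat list" and q :: nat
  assumes q_pos: "0 < q"
    and length_block: "\<forall>a\<in>set [0, 1, 2]. length (f a) = q"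
    and sync: "\<forall>a\<in>set [0, 1, 2]. \<forall>b\<in>set [0, 1, 2]. \<forall>c\<in>set [0, 1, 2]. b \<noteq> c \<longrightarrow>
      (\<forall>i\<in>set [1..<q]. take q (drop i (f b @ f c)) \<noteq> f a)"
    and border: "\<forall>a\<in>set [0, 1, 2]. \<forall>b\<in>set [0, 1, 2]. \<forall>c\<in>set [0, 1, 2]. a \<noteq> b \<and> b \<noteq> c \<longrightarrow>
      (\<forall>i\<in>set [0..<q]. drop i (f a) \<noteq> drop i (f b) \<or> take i (f b) \<noteq> take i (f c))"
begin

lemma length_image: "set w \<subseteq> {0, 1, 2} \<Longrightarrow> length (concat (map f w)) = q * length w"
  using length_block by (induction w) auto

lemma nth_image:
  assumes "set w \<subseteq> {0, 1, 2}" "j < q * length w"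
  shows "concat (map f w) ! j = f (w ! (j div q)) ! (j mod q)"
  using assms
proof (induction w arbitrary: j)
  case (Cons a w)
  then have a: "length (f a) = q" using length_block by auto
  show ?case
  proof (cases "j < q")
    case True
    then show ?thesis using a by (simp add: nth_append)
  next
    case False
    then have "j div q = Suc ((j - q) div q)" "j mod q = (j - q) mod q"
      using q_pos by (simp_all add: le_div_geq le_mod_geq)
    then show ?thesis using False a Cons by (simp add: nth_append)
  qed
qed simp

text \<open>This is \<open>border\<close> at \<open>i = 0\<close>, where the condition on prefixes
  is trivially violated; any \<open>c\<close> other than \<open>b\<close> will do.\<close>

lemma block_inj:
  assumes "a \<in> {0, 1, 2}" "b \<in> {0, 1, 2}" "f a = f b"
  shows "a = b"
proof (rule ccontr)
  assume "a \<noteq> b"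
  moreover obtain c :: nat where "c \<in> {0, 1, 2}" "b \<noteq> c" using assms by force
  moreover have "0 \<in> set [0..<q]" using q_pos by simp
  moreover have "take 0 (f b) = take 0 (f c)" "drop 0 (f a) = drop 0 (f b)" using assms by simp_all
  moreover have "{0, 1, 2} = set [0, 1, 2 :: nat]" by simp
  ultimately show False using border assms(1,2) by metis
qed

text \<open>A root of length \<open>2 * q - 1\<close> or more contains a whole block, whose copy one
  period later must be aligned by \<open>sync\<close>; so \<open>q\<close> divides the period. The
  period then passes to \<open>w\<close>, except at the blocks cut by the ends of the copies of
  \<open>u\<close>. Square-freeness makes these differ, against \<open>border\<close>.\<close>

lemma square_in_image_short:
  assumes w: "set w \<subseteq> {0, 1, 2}" "squares_le 0 w"
    and square: "concat (map f w) = x @ u @ u @ y"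
  shows "length u < 2 * q - 1"
proof (rule ccontr)
  define F where "F = concat (map f w)"
  define r where "r = length u"
  define i where "i = length x"
  assume "\<not> ?thesis"
  then have r: "2 * q - 1 \<le> r" by (simp add: r_def)
  have lenF: "length F = q * length w" unfolding F_def by (rule length_image[OF w(1)])
  have end_le: "i + 2 * r \<le> q * length w"
    using arg_cong[OF square, of length] lenF by (simp add: F_def i_def r_def)
  have nthF: "F ! (b * q + t) = f (w ! b) ! t" if "b < length w" "t < q" for b t
  proof -
    have "b * q + t < Suc b * q" using that by simp
    also have "\<dots> \<le> q * length w"
      using that(1) by (metis Suc_leI mult.commute mult_le_mono2)
    finally show ?thesis using nth_image[OF w(1), of "b * q + t"] that unfolding F_def by simp
  qed
  have period: "F ! j = F ! (j + r)" if j: "i \<le> j" "j < i + r" for j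
  proof -
    obtain t where t: "j = i + t" "t < r" using j by (metis le_Suc_ex nat_add_left_cancel_less)
    have "F ! (i + t) = u ! t" "F ! (i + t + r) = u ! t"
      using t unfolding F_def square i_def r_def by (simp_all add: nth_append)
    then show ?thesis using t by simp
  qed
  have letter: "w ! j \<in> {0, 1, 2}" if "j < length w" for j
    using that w(1) nth_mem by blast
  have len: "length (f (w ! j)) = q" if "j < length w" for j
    using letter[OF that] length_block by auto
  have "r mod q = 0"
  proof (rule ccontr)
    \<comment> \<open>The first block starting at or after \<open>i\<close>. It ends by
      \<open>i + 2 * q - 1\<close>, hence inside the first copy of \<open>u\<close>; its shift
      starts at offset \<open>t\<close> in block \<open>c\<close>.\<close>
    define b where "b = (i + q - 1) div q"
    assume "r mod q \<noteq> 0"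
    have b: "i \<le> b * q" "b * q < i + q"
    proof -
      have "(i + q - 1) mod q < q" "i + q - 1 = b * q + (i + q - 1) mod q"
        using q_pos unfolding b_def by simp_all
      then show "i \<le> b * q" "b * q < i + q" using q_pos by linarith+
    qed
    define c where "c = b + r div q"
    define t where "t = r mod q"
    have t: "1 \<le> t" "t < q" using \<open>r mod q \<noteq> 0\<close> q_pos by (simp_all add: t_def)
    have bc: "b * q + r = c * q + t" unfolding c_def t_def by (simp add: algebra_simps)
    have "Suc c * q < q * length w"
      using bc b r t end_le q_pos by simp
    then have c: "Suc c < length w" by (metis mult.commute nat_mult_less_cancel_disj)
    have "b < length w" using c unfolding c_def by simp
    have "take q (drop t (f (w ! c) @ f (w ! Suc c))) = f (w ! b)"
    proof (rule nth_equalityI)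
      show "length (take q (drop t (f (w ! c) @ f (w ! Suc c)))) = length (f (w ! b))"
        using len c \<open>b < length w\<close> t by simp
      fix k assume "k < length (take q (drop t (f (w ! c) @ f (w ! Suc c))))"
      then have k: "k < q" by simp
      have "f (w ! b) ! k = F ! (b * q + k)" using nthF[OF \<open>b < length w\<close> k] by simp
      also have "\<dots> = F ! (b * q + k + r)" using b k r by (intro period) auto
      also have "b * q + k + r = c * q + (t + k)" using bc by simp
      also have "F ! (c * q + (t + k)) = (f (w ! c) @ f (w ! Suc c)) ! (t + k)"
      proof (cases "t + k < q")
        case True
        then show ?thesis using nthF[of c "t + k"] c len by (simp add: nth_append)
      next
        case False
        then have "c * q + (t + k) = Suc c * q + (t + k - q)" by simp
        then show ?thesis using nthF[of "Suc c" "t + k - q"] c len False t k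
          by (simp add: nth_append)
      qed
      finally show "take q (drop t (f (w ! c) @ f (w ! Suc c))) ! k = f (w ! b) ! k"
        using k t len c by (simp only: nth_take nth_drop length_append)
    qed
    moreover have "w ! c \<noteq> w ! Suc c"
      using squares_le_0D[OF w(2), of 1 c] c by (auto simp: le_less_Suc_eq)
    moreover have "w ! b \<in> set [0, 1, 2]" "w ! c \<in> set [0, 1, 2]" "w ! Suc c \<in> set [0, 1, 2]"
      using letter[OF \<open>b < length w\<close>] letter[OF c] letter[of c] c by simp_all
    moreover have "t \<in> set [1..<q]" using t by simp
    ultimately show False using sync by blast
  qed
  then obtain n where n: "r = n * q" by (metis mod_0_imp_dvd dvdE mult.commute)
  have "0 < n" using n r q_pos by (cases n) auto
  define b where "b = i div q"
  define k where "k = i mod q"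
  have i_eq: "i = b * q + k" and k: "k < q" using q_pos by (simp_all add: b_def k_def)
  have shift: "f (w ! j) ! t = f (w ! (j + n)) ! t"
    if "i \<le> j * q + t" "j * q + t < i + r" "t < q" for j t
  proof -
    have "(j + n) * q < q * length w" using that end_le n by (simp add: algebra_simps)
    then have jn: "j + n < length w" by (metis mult.commute nat_mult_less_cancel_disj)
    have "F ! (j * q + t) = F ! ((j + n) * q + t)"
      using period[of "j * q + t"] that n by (simp add: algebra_simps)
    then show ?thesis using nthF[of j t] nthF[of "j + n" t] that jn by simp
  qed
  have inner: "w ! j = w ! (j + n)" if "i \<le> j * q" "j * q + q \<le> i + r" for j
  proof -
    have "(j + n) * q < q * length w" using that end_le n q_pos by (simp add: algebra_simps)
    then have jn: "j + n < length w" by (metis mult.commute nat_mult_less_cancel_disj)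
    have "f (w ! j) = f (w ! (j + n))"
      using that jn len by (intro nth_equalityI) (auto intro: shift)
    then show ?thesis using letter jn by (intro block_inj) auto
  qed
  have bounds: "j * q + q \<le> i + r" if "j < b + n" for j
  proof -
    have "Suc j * q \<le> (b + n) * q" using that by (intro mult_le_mono1) simp
    then show ?thesis using i_eq n by (simp add: algebra_simps)
  qed
  have lower: "i \<le> j * q" if "b < j" for j
  proof -
    have "Suc b * q \<le> j * q" using that by (intro mult_le_mono1) simp
    then show ?thesis using i_eq k by simp
  qed
  have fits: "b + 2 * n \<le> length w"
  proof -
    have "(b + 2 * n) * q \<le> length w * q" using end_le i_eq n by (simp add: algebra_simps)
    then show ?thesis using q_pos by simp
  qed
  have mid: "w ! j = w ! (j + n)" if "b < j" "j < b + n" for j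
    using inner lower bounds that by blast
  \<comment> \<open>All other positions of the would-be square of \<open>w\<close> at
    \<open>b\<close> agree by \<open>mid\<close>.\<close>
  have left: "w ! b \<noteq> w ! (b + n)"
    using squares_le_0D[OF w(2) \<open>0 < n\<close> fits] mid le_neq_implies_less by blast
  \<comment> \<open>For \<open>k = 0\<close> block \<open>b\<close> would lie in the first copy of
    \<open>u\<close> too and equal block \<open>b + n\<close>.\<close>
  then have "0 < k"
    using inner[of b] bounds[of b] \<open>0 < n\<close> i_eq by (cases k) auto
  then have "(b + 2 * n) * q < length w * q" using end_le i_eq n by (simp add: algebra_simps)
  then have fits': "Suc b + 2 * n \<le> length w" by simp
  \<comment> \<open>The same argument for the would-be square at \<open>Suc b\<close>, where only
    position \<open>b + n\<close> is open.\<close>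
  have right: "w ! (b + n) \<noteq> w ! (b + n + n)"
  proof
    assume *: "w ! (b + n) = w ! (b + n + n)"
    obtain j where j: "Suc b \<le> j" "j < Suc b + n" "w ! j \<noteq> w ! (j + n)"
      using squares_le_0D[OF w(2) \<open>0 < n\<close> fits'] by blast
    then have "j = b + n" using mid[of j] by linarith
    with j * show False by simp
  qed
  \<comment> \<open>The first copy of \<open>u\<close> starts with the end of block \<open>b\<close>
    from offset \<open>k\<close> and ends with the first \<open>k\<close> letters of block
    \<open>b + n\<close>. Both reappear one period later.\<close>
  have "drop k (f (w ! b)) = drop k (f (w ! (b + n)))"
  proof (rule nth_equalityI)
    fix t assume "t < length (drop k (f (w ! b)))"
    then have "k + t < q" using len[of b] fits' by simp
    moreover have "q \<le> n * q" using \<open>0 < n\<close> by simp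
    then have "k + t < n * q" using \<open>k + t < q\<close> by linarith
    ultimately have "f (w ! b) ! (k + t) = f (w ! (b + n)) ! (k + t)"
      using i_eq n by (intro shift) auto
    then show "drop k (f (w ! b)) ! t = drop k (f (w ! (b + n))) ! t"
      using len[of b] len[of "b + n"] fits' \<open>k + t < q\<close> by simp
  qed (use len fits' in simp)
  moreover have "take k (f (w ! (b + n))) = take k (f (w ! (b + n + n)))"
  proof (rule nth_equalityI)
    fix t assume "t < length (take k (f (w ! (b + n))))"
    then have "t < k" by simp
    moreover have "q \<le> n * q" using \<open>0 < n\<close> by simp
    then have "k \<le> n * q" using k by linarith
    ultimately have "f (w ! (b + n)) ! t = f (w ! (b + n + n)) ! t"
      using i_eq n k by (intro shift) (auto simp: algebra_simps)
    then show "take k (f (w ! (b + n))) ! t = take k (f (w ! (b + n + n))) ! t"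
      using \<open>t < k\<close> by simp
  qed (use len fits' in simp)
  moreover have "w ! b \<in> set [0, 1, 2]" "w ! (b + n) \<in> set [0, 1, 2]" "w ! (b + n + n) \<in> set [0, 1, 2]"
    using letter fits' by simp_all
  moreover have "k \<in> set [0..<q]" using k by simp
  ultimately show False using border left right by blast
qed

text \<open>In a shortest preimage \<open>v\<close> the overhang on either side of \<open>y\<close>
  is at most \<open>q - 1\<close>, since a whole block could be dropped. The two units missing from
  \<open>2 * q\<close> are the \<open>+ 2\<close>.\<close>

lemma factor_of_image:
  assumes w: "set w \<subseteq> {0, 1, 2}" and y: "sublist y (concat (map f w))"
  shows "\<exists>v. sublist v w \<and> sublist y (concat (map f v)) \<and> q * length v + 2 \<le> length y + 2 * q"
proof -
  define P where "P v \<longleftrightarrow> sublist v w \<and> sublist y (concat (map f v))" for v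
  obtain v where v: "P v" and min: "\<And>v'. P v' \<Longrightarrow> length v \<le> length v'"
    using ex_has_least_nat[of P w length] w y unfolding P_def by blast
  have set_v: "set v \<subseteq> {0, 1, 2}" using v w set_mono_sublist unfolding P_def by blast
  obtain x z where xz: "concat (map f v) = x @ y @ z" using v unfolding P_def sublist_def by blast
  have "length x < q"
  proof (rule ccontr)
    assume x: "\<not> length x < q"
    show False
    proof (cases v)
      case Nil
      then show False using xz x q_pos by simp
    next
      case (Cons a v')
      then have "length (f a) = q" using set_v length_block by auto
      then have "concat (map f v') = drop q x @ y @ z"
        using xz Cons x by (auto simp: append_eq_append_conv_if)
      moreover have "sublist v' v" using Cons by (simp add: sublist_Cons_right)
      ultimately have "P v'" using v unfolding P_def by (metis sublist_appendI sublist_order.order_trans)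
      then show False using min Cons by fastforce
    qed
  qed
  moreover have "length z < q"
  proof (rule ccontr)
    assume z: "\<not> length z < q"
    show False
    proof (cases v rule: rev_cases)
      case Nil
      then show False using xz z q_pos by simp
    next
      case (snoc v' a)
      then have a: "length (f a) = q" using set_v length_block by auto
      have "concat (map f v') = take (length (concat (map f v'))) (concat (map f v))"
        using snoc by simp
      also have "length (concat (map f v')) = length (x @ y @ z) - q"
        unfolding xz[symmetric] using snoc a by simp
      also have "take (length (x @ y @ z) - q) (concat (map f v)) = x @ y @ take (length z - q) z"
        unfolding xz using z by simp
      finally have "sublist y (concat (map f v'))" by simp
      moreover have "sublist v' v" using snoc by simp
      ultimately have "P v'" using v unfolding P_def by (metis sublist_order.order_trans)
      then show False using min snoc by fastforce
    qed
  qed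
  moreover have "q * length v = length x + length y + length z"
    using length_image[OF set_v] xz by simp
  ultimately show ?thesis using v unfolding P_def by (intro exI[of _ v]) linarith
qed

end

section \<open>Finite lists containing all short ternary square-free words\<close>

fun no_short_square :: "nat list \<Rightarrow> bool" where
  "no_short_square (a # b # c # d # s) =
     (a \<noteq> b \<and> \<not> (a = c \<and> b = d) \<and> no_short_square (b # c # d # s))"
| "no_short_square [a, b, c] = (a \<noteq> b \<and> b \<noteq> c)"
| "no_short_square [a, b] = (a \<noteq> b)"
| "no_short_square _ = True"

lemma no_short_square_if_squares_le_0:
  assumes "squares_le 0 w"
  shows "no_short_square w"
proof -
  have no: "w \<noteq> x @ u @ u @ y" if "squares_le 0 w" "u \<noteq> []" for w x u y :: "nat list"
    using that unfolding squares_le_def sublist_def by force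
  show ?thesis
    using assms
  proof (induction w rule: no_short_square.induct)
    case (1 a b c d s)
    have "squares_le 0 (b # c # d # s)"
      using 1 squares_le_sublist by (metis sublist_Cons_right sublist_order.order_refl)
    then show ?case using 1 no[of _ "[a]" "[]"] no[of _ "[a, b]" "[]"] by auto
  next
    case (2 a b c)
    then show ?case using no[of _ "[a]" "[]"] no[of _ "[b]" "[a]"] by auto
  next
    case (3 a b)
    then show ?case using no[of _ "[a]" "[]"] by auto
  qed simp_all
qed

text \<open>Only roots of length 1 and 2 are filtered out, so words with longer squares may remain.
  This is harmless: the list serves as the range of universal checks.\<close>

definition ternary_squarefree :: "nat \<Rightarrow> nat list list" where
  "ternary_squarefree n =
     filter no_short_square (concat (map (\<lambda>k. List.n_lists k [0, 1, 2]) [0..<Suc n]))"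

lemma in_ternary_squarefree:
  assumes "set w \<subseteq> {0, 1, 2}" "squares_le 0 w" "length w \<le> n"
  shows "w \<in> set (ternary_squarefree n)"
  using assms unfolding ternary_squarefree_def by (auto simp: no_short_square_if_squares_le_0 set_n_lists)

context sync_morphism
begin

lemma short_factor_of_image:
  assumes w: "set w \<subseteq> {0, 1, 2}" "squares_le 0 w" and y: "sublist y (concat (map f w))"
    and len: "length y + 2 * q < q * Suc n + 2"
  shows "\<exists>v\<in>set (ternary_squarefree n). sublist y (concat (map f v))"
proof -
  obtain v where v: "sublist v w" "sublist y (concat (map f v))" "q * length v + 2 \<le> length y + 2 * q"
    using factor_of_image[OF w(1) y] by blast
  then have "q * length v < q * Suc n" using len by linarith
  then have "length v \<le> n" by (metis less_Suc_eq_le nat_mult_less_cancel_disj)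
  moreover have "set v \<subseteq> {0, 1, 2}" using v(1) w(1) set_mono_sublist by blast
  ultimately have "v \<in> set (ternary_squarefree n)"
    using squares_le_sublist[OF w(2) v(1)] by (intro in_ternary_squarefree)
  with v show ?thesis by blast
qed

text \<open>Roots have length at most \<open>2 * q - 2\<close>, so a square has length at most
  \<open>4 * q - 4\<close> and is covered by the image of at most 5 letters.\<close>

lemma squares_le_image:
  assumes w: "set w \<subseteq> {0, 1, 2}" "squares_le 0 w"
    and small: "\<forall>v\<in>set (ternary_squarefree 5). no_square_above N (concat (map f v))"
  shows "squares_le N (concat (map f w))"
  unfolding squares_le_def
proof (intro allI impI)
  fix u assume u: "sublist (u @ u) (concat (map f w))"
  then obtain x y where "concat (map f w) = x @ u @ u @ y" unfolding sublist_def by auto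
  then have "length u < 2 * q - 1" by (rule square_in_image_short[OF w])
  then have "length (u @ u) + 2 * q < q * Suc 5 + 2" by simp
  then obtain v where "v \<in> set (ternary_squarefree 5)" "sublist (u @ u) (concat (map f v))"
    using short_factor_of_image[OF w u] by blast
  then show "length u \<le> N" using small squares_leI unfolding squares_le_def by blast
qed

end

section \<open>Leech's morphism and ternary square-free words of every length\<close>

definition leech :: "nat \<Rightarrow> nat list" where
  "leech = (!) [[0,1,2,1,0,2,1,2,0,1,2,1,0], [1,2,0,2,1,0,2,0,1,2,0,2,1], [2,0,1,0,2,1,0,1,2,0,1,0,2]]"

interpretation leech: sync_morphism leech 13
  by (unfold_locales; code_simp)

lemma squares_le_leech: "\<forall>v\<in>set (ternary_squarefree 5). no_square_above 0 (concat (map leech v))"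
  by code_simp

text \<open>Applying \<open>leech\<close> preserves square-freeness and multiplies the length by 13;
  prefixes give the exact length.\<close>

lemma ternary_squarefree_exists:
  "\<exists>w. length w = n \<and> set w \<subseteq> {0, 1, 2 :: nat} \<and> squares_le 0 w"
proof -
  have "\<exists>w. n < length w \<and> set w \<subseteq> {0, 1, 2 :: nat} \<and> squares_le 0 w"
  proof (induction n)
    case 0
    have "squares_le 0 [0 :: nat]" by (rule squares_leI) code_simp
    then show ?case by (intro exI[of _ "[0]"]) simp
  next
    case (Suc n)
    then obtain w where w: "n < length w" "set w \<subseteq> {0, 1, 2 :: nat}" "squares_le 0 w" by blast
    have "\<forall>a\<in>{0, 1, 2}. set (leech a) \<subseteq> {0, 1, 2}" by (simp add: leech_def)
    then have "set x \<subseteq> {0, 1, 2}" if "x \<in> set (map leech w)" for x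
      using that w(2) by (metis imageE set_map subsetD)
    then have "set (concat (map leech w)) \<subseteq> {0, 1, 2}" unfolding set_concat by (rule UN_least)
    moreover have "squares_le 0 (concat (map leech w))"
      by (rule leech.squares_le_image[OF w(2,3) squares_le_leech])
    moreover have "Suc n < length (concat (map leech w))"
      using leech.length_image[OF w(2)] w(1) by simp
    ultimately show ?case by blast
  qed
  then obtain w where w: "n < length w" "set w \<subseteq> {0, 1, 2 :: nat}" "squares_le 0 w" by blast
  have "set (take n w) \<subseteq> {0, 1, 2}" by (rule subset_trans[OF set_take_subset w(2)])
  then show ?thesis using w squares_le_sublist[OF w(3) sublist_take, of n]
    by (intro exI[of _ "take n w"]) simp
qed

lemma avoidable_over_3_square:
  assumes "s \<noteq> []"
  shows "avoidable_over 3 (s @ s)"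
  unfolding avoidable_over_def
proof
  fix n
  obtain w where w: "length w = n" "set w \<subseteq> {0, 1, 2 :: nat}" "squares_le 0 w"
    using ternary_squarefree_exists by blast
  have "instance_free (s @ s) w"
    unfolding instance_free_def
  proof (intro allI impI notI)
    fix h :: "'a \<Rightarrow> nat list"
    assume h: "\<forall>X. h X \<noteq> []" "sublist (concat (map h (s @ s))) w"
    then have "concat (map h s) = []"
      using w(3) unfolding squares_le_def by (metis concat_append le_zero_eq length_0_conv map_append)
    then show False using h(1) assms by (cases s) auto
  qed
  then have "w \<in> good_words 3 (s @ s) n" using w unfolding good_words_def by auto
  then show "good_words 3 (s @ s) n \<noteq> {}" by blast
qed

lemma (in sync_morphism) avoidable_over_image:
  assumes letters: "\<forall>a\<in>set [0, 1, 2]. set (f a) \<subseteq> {..<m}"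
    and free: "\<And>w. set w \<subseteq> {0, 1, 2} \<Longrightarrow> squares_le 0 w \<Longrightarrow>
      set (concat (map f w)) \<subseteq> {..<m} \<Longrightarrow> instance_free p (concat (map f w))"
  shows "avoidable_over m p"
  unfolding avoidable_over_def
proof
  fix n
  obtain w where w: "length w = n" "set w \<subseteq> {0, 1, 2 :: nat}" "squares_le 0 w"
    using ternary_squarefree_exists by blast
  let ?u = "concat (map f w)"
  have "set ?u \<subseteq> {..<m}" using letters w(2) by fastforce
  then have "?u \<in> good_words m p (length ?u)" using free w unfolding good_words_def by simp
  then have "take n ?u \<in> good_words m p (length (take n ?u))"
    by (rule good_words_sublist) (rule sublist_take)
  moreover have "length (take n ?u) = n" using length_image[OF w(2)] w(1) q_pos by simp
  ultimately show "good_words m p n \<noteq> {}" by auto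
qed

section \<open>Binary images without cubes, overlaps or long squares\<close>

definition binary_words :: "nat \<Rightarrow> nat list list" where
  "binary_words n = concat (map (\<lambda>k. List.n_lists k [0, 1]) [1..<Suc n])"

lemma in_binary_words:
  assumes "set u \<subseteq> {..<2}" "u \<noteq> []" "length u \<le> n"
  shows "u \<in> set (binary_words n)"
proof -
  have "u \<in> set (List.n_lists (length u) [0, 1])"
    using assms by (auto simp: set_n_lists less_2_cases_iff)
  moreover have "length u \<in> set [1..<Suc n]" using assms by (cases u) auto
  ultimately show ?thesis unfolding binary_words_def by auto
qed

text \<open>This morphism and the two below were found by computer search. In the image of a square-free
  word all squares are short. Every variable of the patterns in question occurs in a square, so
  their instances are short as well and only finitely many words have to be excluded.\<close>
definition cubefree :: "nat \<Rightarrow> nat list" where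
  "cubefree = (!) [[0,0,1,0,0,1,1], [0,0,1,1,0,1,1], [0,1,0,1,1,0,1]]"

interpretation cubefree: sync_morphism cubefree 7
  by (unfold_locales; code_simp)

lemma squares_le_cubefree: "\<forall>v\<in>set (ternary_squarefree 5). no_square_above 5 (concat (map cubefree v))"
  by code_simp

text \<open>Roots of length at most 5 give cubes of length at most 15, which the images of 3 letters
  cover.\<close>

lemma no_short_cubes: "\<forall>v\<in>set (ternary_squarefree 3). \<forall>u\<in>set (binary_words 5).
    \<not> sublist (u @ u @ u) (concat (map cubefree v))"
  by code_simp

lemma avoidable_over_2_cube: "avoidable_over 2 [X, X, X]"
proof (rule cubefree.avoidable_over_image)
  show "\<forall>a\<in>set [0, 1, 2]. set (cubefree a) \<subseteq> {..<2}" by (auto simp: cubefree_def)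
  fix w assume w: "set w \<subseteq> {0, 1, 2}" "squares_le 0 w"
    and binary: "set (concat (map cubefree w)) \<subseteq> {..<2}"
  show "instance_free [X, X, X] (concat (map cubefree w))"
    unfolding instance_free_def
  proof (intro allI impI notI)
    fix h :: "'a \<Rightarrow> nat list"
    assume h: "\<forall>X. h X \<noteq> []" "sublist (concat (map h [X, X, X])) (concat (map cubefree w))"
    let ?u = "h X"
    have cube: "sublist (?u @ ?u @ ?u) (concat (map cubefree w))" using h(2) by simp
    then have "sublist (?u @ ?u) (concat (map cubefree w))"
      by (metis sublist_append_leftI sublist_order.order_trans)
    then have len: "length ?u \<le> 5"
      using cubefree.squares_le_image[OF w squares_le_cubefree] unfolding squares_le_def by blast
    have "set ?u \<subseteq> {..<2}" using subset_trans[OF set_mono_sublist[OF cube] binary] by simp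
    then have "?u \<in> set (binary_words 5)" using h(1) len by (intro in_binary_words) auto
    moreover obtain v where "v \<in> set (ternary_squarefree 3)"
        "sublist (?u @ ?u @ ?u) (concat (map cubefree v))"
      using cubefree.short_factor_of_image[OF w cube, of 3] len by auto
    ultimately show False using no_short_cubes by blast
  qed
qed

definition overlapfree :: "nat \<Rightarrow> nat list" where
  "overlapfree = (!) [[0,0,0,0,1,1,1], [0,0,0,1,0,1,1], [0,0,0,1,1,0,1]]"

interpretation overlapfree: sync_morphism overlapfree 7
  by (unfold_locales; code_simp)

lemma squares_le_overlapfree:
  "\<forall>v\<in>set (ternary_squarefree 5). no_square_above 2 (concat (map overlapfree v))"
  by code_simp

text \<open>The square of \<open>a @ b\<close> has root length at most 2, so \<open>a\<close> and
  \<open>b\<close> are single letters.\<close>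

lemma no_short_overlaps: "\<forall>v\<in>set (ternary_squarefree 2). \<forall>a\<in>set (binary_words 1).
    \<forall>b\<in>set (binary_words 1). \<not> sublist (a @ b @ a @ b @ a) (concat (map overlapfree v))"
  by code_simp

lemma avoidable_over_2_overlap: "avoidable_over 2 [X, Y, X, Y, X]"
proof (rule overlapfree.avoidable_over_image)
  show "\<forall>a\<in>set [0, 1, 2]. set (overlapfree a) \<subseteq> {..<2}" by (auto simp: overlapfree_def)
  fix w assume w: "set w \<subseteq> {0, 1, 2}" "squares_le 0 w"
    and binary: "set (concat (map overlapfree w)) \<subseteq> {..<2}"
  show "instance_free [X, Y, X, Y, X] (concat (map overlapfree w))"
    unfolding instance_free_def
  proof (intro allI impI notI)
    fix h :: "'a \<Rightarrow> nat list"
    assume h: "\<forall>X. h X \<noteq> []"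
      "sublist (concat (map h [X, Y, X, Y, X])) (concat (map overlapfree w))"
    let ?a = "h X" and ?b = "h Y"
    have overlap: "sublist (?a @ ?b @ ?a @ ?b @ ?a) (concat (map overlapfree w))" using h(2) by simp
    moreover have "sublist ((?a @ ?b) @ (?a @ ?b)) (?a @ ?b @ ?a @ ?b @ ?a)"
      by (metis append.assoc sublist_append_rightI)
    ultimately have "sublist ((?a @ ?b) @ (?a @ ?b)) (concat (map overlapfree w))"
      by (metis sublist_order.order_trans)
    then have "length (?a @ ?b) \<le> 2"
      using overlapfree.squares_le_image[OF w squares_le_overlapfree] unfolding squares_le_def by blast
    moreover have "0 < length ?a" "0 < length ?b" using h(1) by simp_all
    ultimately have len: "length ?a = 1" "length ?b = 1" by (simp_all del: length_greater_0_conv)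
    have "set ?a \<subseteq> {..<2}" "set ?b \<subseteq> {..<2}"
      using subset_trans[OF set_mono_sublist[OF overlap] binary] by simp_all
    then have "?a \<in> set (binary_words 1)" "?b \<in> set (binary_words 1)"
      using h(1) len by (auto intro!: in_binary_words)
    moreover obtain v where "v \<in> set (ternary_squarefree 2)"
        "sublist (?a @ ?b @ ?a @ ?b @ ?a) (concat (map overlapfree v))"
      using overlapfree.short_factor_of_image[OF w overlap, of 2] len by auto
    ultimately show False using no_short_overlaps by blast
  qed
qed

definition few_squares :: "nat \<Rightarrow> nat list" where
  "few_squares = (!) [[0,0,0,0,0,1,0,1,0,1,1,1], [1,0,1,0,1,0,0,0,0,1,1,1], [1,1,0,0,0,1,0,1,0,1,1,1]]"

interpretation few_squares: sync_morphism few_squares 12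
  by (unfold_locales; code_simp)

lemma squares_le_few_squares:
  "\<forall>v\<in>set (ternary_squarefree 5). no_square_above 2 (concat (map few_squares v))"
  by code_simp

text \<open>With \<open>A\<close> for \<open>False\<close> and \<open>B\<close> for \<open>True\<close>:
  \<open>AABABB, AABBAA, AABBAB, ABAABB, ABABBA, ABBAAB, ABBABA\<close>.\<close>
definition two_square_patterns :: "bool list list" where
  "two_square_patterns =
    [[False, False, True, False, True, True], [False, False, True, True, False, False],
     [False, False, True, True, False, True], [False, True, False, False, True, True],
     [False, True, False, True, True, False], [False, True, True, False, False, True],
     [False, True, True, False, True, False]]"

text \<open>Images of length at most 2 give instances of length at most 12, which the images of 2
  letters cover.\<close>

lemma no_short_instances: "\<forall>v\<in>set (ternary_squarefree 2). \<forall>r\<in>set two_square_patterns.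
    \<forall>a\<in>set (binary_words 2). \<forall>b\<in>set (binary_words 2).
      \<not> sublist (concat (map (\<lambda>X. if X then b else a) r)) (concat (map few_squares v))"
  by code_simp

section \<open>Patterns with at most two variables\<close>

lemma length_concat_map_le:
  assumes "\<And>X. length (h X) \<le> n"
  shows "length (concat (map h r)) \<le> n * length r"
proof (induction r)
  case (Cons a r)
  then show ?case using add_mono[OF assms[of a] Cons.IH] by simp
qed simp

lemma few_squares_instance_free:
  fixes h :: "bool \<Rightarrow> nat list"
  assumes w: "set w \<subseteq> {0, 1, 2}" "squares_le 0 w"
    and binary: "set (concat (map few_squares w)) \<subseteq> {..<2}"
    and h: "\<forall>X. h X \<noteq> []" "r \<in> set two_square_patterns" "length (h False) \<le> 2" "length (h True) \<le> 2"
  shows "\<not> sublist (concat (map h r)) (concat (map few_squares w))"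
proof
  assume sub: "sublist (concat (map h r)) (concat (map few_squares w))"
  have len_r: "length r = 6" and set_r: "{False, True} \<subseteq> set r"
    using h(2) unfolding two_square_patterns_def by auto
  have len_h: "length (h X) \<le> 2" for X using h(3,4) by (cases X) auto
  have "length (concat (map h r)) \<le> 2 * length r"
    by (rule length_concat_map_le[OF len_h])
  then obtain v where v: "v \<in> set (ternary_squarefree 2)"
      "sublist (concat (map h r)) (concat (map few_squares v))"
    using few_squares.short_factor_of_image[OF w sub, of 2] len_r by auto
  have "set (h X) \<subseteq> {..<2}" for X
    using subset_trans[OF set_mono_sublist[OF sub] binary] set_r by (cases X) auto
  then have "h X \<in> set (binary_words 2)" for X
    using h(1) len_h by (intro in_binary_words) auto
  moreover have "h = (\<lambda>X. if X then h True else h False)" by auto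
  ultimately show False using no_short_instances v h(2) by metis
qed

text \<open>If a cube or an overlap is present, the earlier morphisms apply. Otherwise
  \<open>few_squares\<close> does: its images have only roots of length at most 2, which bounds the
  images of both variables.\<close>

lemma avoidable_over_2_length_6:
  fixes r :: "bool list"
  assumes "length r = 6" "hd r = False"
  shows "avoidable_over 2 r"
proof (cases "(\<exists>X. sublist [X, X, X] r) \<or> (\<exists>X Y. sublist [X, Y, X, Y, X] r)")
  case True
  then show ?thesis
    by (auto intro: avoidable_over_sublist[OF avoidable_over_2_cube]
        avoidable_over_sublist[OF avoidable_over_2_overlap])
next
  case False
  obtain b1 b2 b3 b4 b5 where r: "r = [False, b1, b2, b3, b4, b5]"
    using assms by (auto simp: length_Suc_conv eval_nat_numeral)
  \<comment> \<open>The three additional patterns are the squares of AAB, ABA and ABB. Their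
    instances have roots of length at least 3 and so do not occur.\<close>
  have patterns: "r \<in> set (two_square_patterns @ [[False, False, True, False, False, True],
      [False, True, False, False, True, False], [False, True, True, False, True, True]])"
    using False unfolding r two_square_patterns_def
    by (cases b1; cases b2; cases b3; cases b4; cases b5) (auto simp: sublist_Cons_right)
  show ?thesis
  proof (rule few_squares.avoidable_over_image)
    show "\<forall>a\<in>set [0, 1, 2]. set (few_squares a) \<subseteq> {..<2}" by (auto simp: few_squares_def)
    fix w assume w: "set w \<subseteq> {0, 1, 2}" "squares_le 0 w"
      and binary: "set (concat (map few_squares w)) \<subseteq> {..<2}"
    show "instance_free r (concat (map few_squares w))"
      unfolding instance_free_def
    proof (intro allI impI notI)
      fix h :: "bool \<Rightarrow> nat list"
      assume h: "\<forall>X. h X \<noteq> []" and sub: "sublist (concat (map h r)) (concat (map few_squares w))"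
      let ?A = "h False" and ?B = "h True"
      have root: "length y \<le> 2" if y: "concat (map h r) = x @ y @ y @ z" for x y z
      proof -
        have "sublist (y @ y) (concat (map h r))" unfolding y sublist_def by auto
        then show ?thesis
          using few_squares.squares_le_image[OF w squares_le_few_squares] sub
          unfolding squares_le_def by (meson sublist_order.order_trans)
      qed
      have pos: "0 < length ?A" "0 < length ?B" using h by simp_all
      have "r \<in> set two_square_patterns \<and> length ?A \<le> 2 \<and> length ?B \<le> 2"
        using patterns unfolding two_square_patterns_def
      proof (simp, elim disjE, goal_cases)
        case 1
        then show ?case using root[of "[]" ?A "?B @ ?A @ ?B @ ?B"] root[of "?A @ ?A @ ?B @ ?A" ?B "[]"] by simp
      next
        case 2
        then show ?case using root[of "[]" ?A "?B @ ?B @ ?A @ ?A"] root[of "?A @ ?A" ?B "?A @ ?A"] by simp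
      next
        case 3
        then show ?case using root[of "[]" ?A "?B @ ?B @ ?A @ ?B"] root[of "?A @ ?A" ?B "?A @ ?B"] by simp
      next
        case 4
        then show ?case using root[of "?A @ ?B" ?A "?B @ ?B"] root[of "?A @ ?B @ ?A @ ?A" ?B "[]"] by simp
      next
        case 5
        then show ?case using root[of "[]" "?A @ ?B" "?B @ ?A"] by simp
      next
        case 6
        then show ?case using root[of ?A ?B "?A @ ?A @ ?B"] root[of "?A @ ?B @ ?B" ?A ?B] by simp
      next
        case 7
        then show ?case using root[of "?A @ ?B" "?B @ ?A" "[]"] by simp
      next
        case 8
        then show ?case using root[of "[]" "?A @ ?A @ ?B" "[]"] pos by simp
      next
        case 9
        then show ?case using root[of "[]" "?A @ ?B @ ?A" "[]"] pos by simp
      next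
        case 10
        then show ?case using root[of "[]" "?A @ ?B @ ?B" "[]"] pos by simp
      qed
      then show False using few_squares_instance_free[OF w binary h] sub by blast
    qed
  qed
qed

lemma avoidable_over_3_two_variables:
  assumes "card (set p) \<le> 2" "2 ^ card (set p) \<le> length p" "p \<noteq> []"
  shows "avoidable_over 3 p"
proof (cases "card (set p) = 1")
  case True
  then obtain X where X: "set p = {X}" by (meson card_1_singletonE)
  obtain a b q where p: "p = a # b # q" using assms(2) True by (cases p; cases "tl p") auto
  then have "p = ([X] @ [X]) @ q" using X by auto
  then have "sublist ([X] @ [X]) p" by (metis sublist_append_rightI)
  then show ?thesis using avoidable_over_sublist[OF avoidable_over_3_square] by blast
next
  case False
  moreover have "card (set p) \<noteq> 0" using assms by simp
  ultimately have two: "card (set p) = 2" using assms by linarith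
  then obtain X Y where XY: "set p = {X, Y}" by (meson card_2_iff)
  have "4 \<le> length p" using assms(2) two by simp
  then obtain a b c d q where p: "p = a # b # c # d # q"
    by (auto simp: Suc_le_length_iff eval_nat_numeral)
  \<comment> \<open>With two letters and no equal neighbours the four letters alternate.\<close>
  consider "a = b" | "b = c" | "c = d" | "a = c" "b = d"
  proof -
    have "{a, b, c, d} \<subseteq> {X, Y}" using XY unfolding p by auto
    then show thesis using that by (metis insert_subset insertE singletonD)
  qed
  then have "\<exists>s. s \<noteq> [] \<and> sublist (s @ s) p"
  proof cases
    case 1
    then show ?thesis by (intro exI[of _ "[a]"]) (simp add: p sublist_Cons_right)
  next
    case 2
    then show ?thesis by (intro exI[of _ "[b]"]) (simp add: p sublist_Cons_right)
  next
    case 3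
    then show ?thesis by (intro exI[of _ "[c]"]) (simp add: p sublist_Cons_right)
  next
    case 4
    then show ?thesis by (intro exI[of _ "[a, b]"]) (simp add: p sublist_Cons_right)
  qed
  then show ?thesis using avoidable_over_sublist[OF avoidable_over_3_square] by blast
qed

lemma avoidable_over_2_two_variables:
  assumes "card (set p) \<le> 2" "3 * 2 ^ (card (set p) - 1) \<le> length p" "p \<noteq> []"
  shows "avoidable_over 2 p"
proof (cases "card (set p) = 1")
  case True
  then obtain X where X: "set p = {X}" by (meson card_1_singletonE)
  have "3 \<le> length p" using assms(2) True by simp
  then obtain a b c q where p: "p = a # b # c # q"
    by (auto simp: Suc_le_length_iff eval_nat_numeral)
  then have "p = [X, X, X] @ q" using X by auto
  then have "sublist [X, X, X] p" by (metis sublist_append_rightI)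
  then show ?thesis by (rule avoidable_over_sublist[OF avoidable_over_2_cube])
next
  case False
  moreover have "card (set p) \<noteq> 0" using assms by simp
  ultimately have two: "card (set p) = 2" using assms by linarith
  \<comment> \<open>The first variable becomes \<open>False\<close>, as the normal form of
    \<open>avoidable_over_2_length_6\<close> requires.\<close>
  define \<phi> where "\<phi> X \<longleftrightarrow> X \<noteq> hd p" for X
  obtain Y where Y: "set p = {hd p, Y}"
    using two assms(3) by (metis card_2_iff doubleton_eq_iff hd_in_set insertE singletonD)
  have "set (take 6 p) \<subseteq> set p" by (rule set_take_subset)
  then have "inj_on \<phi> (set (take 6 p))"
    using Y unfolding inj_on_def \<phi>_def by blast
  moreover have "avoidable_over 2 (map \<phi> (take 6 p))"
    using assms(2,3) two by (intro avoidable_over_2_length_6) (simp_all add: hd_map \<phi>_def)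
  ultimately show ?thesis using avoidable_over_map_sublist sublist_take by blast
qed

section \<open>Numerical estimates for at least three variables, each repeated\<close>

lemma avoidable_over_3_doubled:
  assumes "2 ^ card (set p) \<le> length p" "\<forall>X\<in>set p. 2 \<le> count_list p X" "3 \<le> card (set p)"
  shows "avoidable_over 3 p"
proof (rule avoidable_over_by_counting[where x = "2 / 5"])
  have "8 * 2 ^ (card (set p) - 3) \<le> length p"
  proof -
    obtain j where j: "card (set p) = 3 + j" using assms(3) by (metis le_Suc_ex)
    show ?thesis using assms(1) unfolding j by (simp add: power_add)
  qed
  \<comment> \<open>With \<open>m = 3\<close> and \<open>x = 2 / 5\<close>, \<open>75 / 13\<close>
    is \<open>m / (1 - m * x\<^sup>2)\<close> and \<open>1 / 5\<close> is \<open>m * x - 1\<close>.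
    Three variables force length 8.\<close>
  from doubled_bound[OF _ _ _ _ _ assms(3) this, of "75 / 13" "2 / 5" "1 / 5"]
  have "(75 / 13 :: real) ^ card (set p) * (2 / 5) ^ length p \<le> 1 / 5"
    by (simp add: power_divide)
  then show "(real 3 / (1 - real 3 * (2 / 5)\<^sup>2)) ^ card (set p) * (2 / 5) ^ length p \<le> real 3 * (2 / 5) - 1"
    by (simp add: power2_eq_square)
qed (use assms in \<open>auto simp: power2_eq_square\<close>)

lemma avoidable_over_2_doubled:
  assumes "3 * 2 ^ (card (set p) - 1) \<le> length p" "\<forall>X\<in>set p. 2 \<le> count_list p X" "3 \<le> card (set p)"
  shows "avoidable_over 2 p"
proof (rule avoidable_over_by_counting[where x = "27 / 50"])
  have "12 * 2 ^ (card (set p) - 3) \<le> length p"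
  proof -
    obtain j where j: "card (set p) = 3 + j" using assms(3) by (metis le_Suc_ex)
    have "(2 :: nat) ^ (card (set p) - 1) = 4 * 2 ^ j" unfolding j by (simp add: power_add flip: add_2_eq_Suc)
    then show ?thesis using assms(1) j by simp
  qed
  \<comment> \<open>The same quantities for \<open>m = 2\<close> and \<open>x = 27 / 50\<close>;
    three variables now force length 12.\<close>
  from doubled_bound[OF _ _ _ _ _ assms(3) this, of "2500 / 521" "27 / 50" "2 / 25"]
  have "(2500 / 521 :: real) ^ card (set p) * (27 / 50) ^ length p \<le> 2 / 25"
    by (simp add: power_divide)
  then show "(real 2 / (1 - real 2 * (27 / 50)\<^sup>2)) ^ card (set p) * (27 / 50) ^ length p
      \<le> real 2 * (27 / 50) - 1"
    by (simp add: power2_eq_square)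
qed (use assms in \<open>auto simp: power2_eq_square\<close>)

section \<open>Removing variables that occur once, and the conclusion\<close>

lemma avoidable_over_reduction:
  fixes c :: nat
  assumes small: "\<And>p :: 'v list. p \<noteq> [] \<Longrightarrow> card (set p) \<le> 2 \<Longrightarrow> c * 2 ^ (card (set p) - 1) \<le> length p
      \<Longrightarrow> avoidable_over m p"
    and doubled: "\<And>p :: 'v list. c * 2 ^ (card (set p) - 1) \<le> length p \<Longrightarrow>
      \<forall>X\<in>set p. 2 \<le> count_list p X \<Longrightarrow> 3 \<le> card (set p) \<Longrightarrow> avoidable_over m p"
    and "0 < c" "p \<noteq> []" "c * 2 ^ (card (set p) - 1) \<le> length p"
  shows "avoidable_over m (p :: 'v list)"
  using assms(4,5)
proof (induction "card (set p)" arbitrary: p rule: less_induct)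
  case less
  show ?case
  proof (cases "card (set p) \<le> 2")
    case True
    then show ?thesis using small less.prems by blast
  next
    case big: False
    show ?thesis
    proof (cases "\<forall>X\<in>set p. 2 \<le> count_list p X")
      case True
      then show ?thesis using doubled less.prems big by simp
    next
      case False
      then obtain X where X: "X \<in> set p" "count_list p X < 2" by auto
      obtain u v where p: "p = u @ X # v" using X(1) by (meson split_list)
      then have "count_list u X = 0" "count_list v X = 0" using X(2) by auto
      then have notin: "X \<notin> set u" "X \<notin> set v" by (simp_all add: count_list_0_iff)
      \<comment> \<open>The longer side of the single occurrence: it loses the variable
        \<open>X\<close> but keeps about half of the length.\<close>
      define q where "q = (if length v \<le> length u then u else v)"
      have "set q \<subseteq> set p - {X}" using p notin unfolding q_def by auto
      then have "card (set q) \<le> card (set p - {X})" by (intro card_mono) auto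
      then have card_q: "card (set q) \<le> card (set p) - 1" using X(1) by simp
      have len: "length p \<le> 2 * length q + 1" unfolding p q_def by simp
      have "card (set p) - 1 = Suc (card (set p) - 2)" using big by simp
      then have "2 * (c * 2 ^ (card (set p) - 2)) \<le> 2 * length q + 1"
        using less.prems(2) len by (simp add: mult_ac)
      \<comment> \<open>Parity absorbs the letter \<open>X\<close> itself: the left side is
        even.\<close>
      then have half: "c * 2 ^ (card (set p) - 2) \<le> length q" by linarith
      moreover have "c * 2 ^ (card (set q) - 1) \<le> c * 2 ^ (card (set p) - 2)"
        using card_q by (intro mult_le_mono2 power_increasing) auto
      moreover have "0 < c * 2 ^ (card (set p) - 2)" using \<open>0 < c\<close> by simp
      ultimately have "0 < length q" "c * 2 ^ (card (set q) - 1) \<le> length q" by linarith+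
      moreover have "card (set q) < card (set p)" using card_q big by linarith
      ultimately have "avoidable_over m q" using less.hyps by simp
      moreover have "sublist q p" unfolding q_def p by (auto simp: sublist_append sublist_Cons_right)
      ultimately show ?thesis by (rule avoidable_over_sublist)
    qed
  qed
qed

theorem theorem2:
  fixes k :: nat and p :: "'v list"
  assumes "k \<ge> 1"
    and "p \<noteq> []"
    and "card (set p) = k"
  shows "(length p \<ge> 2 ^ k \<longrightarrow> avoidability_index p \<le> 3) \<and>
         (length p \<ge> 3 * 2 ^ (k - 1) \<longrightarrow> avoidability_index p = 2)"
proof (intro conjI impI)
  \<comment> \<open>Puts the bound of the first claim into the form of the reduction with
    \<open>c = 2\<close>; the second claim uses \<open>c = 3\<close>.\<close>
  have double: "2 * 2 ^ (card (set q) - 1) = (2 :: nat) ^ card (set q)" if "q \<noteq> []" for q :: "'v list"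
    using that by (cases "card (set q)") simp_all
  assume "length p \<ge> 2 ^ k"
  then have "2 * 2 ^ (card (set p) - 1) \<le> length p" using double[OF assms(2)] assms(3) by simp
  moreover have "avoidable_over 3 q" if "q \<noteq> []" "card (set q) \<le> 2" "2 * 2 ^ (card (set q) - 1) \<le> length q"
    for q :: "'v list" using that double by (intro avoidable_over_3_two_variables) simp_all
  moreover have "avoidable_over 3 q" if "2 * 2 ^ (card (set q) - 1) \<le> length q"
      "\<forall>X\<in>set q. 2 \<le> count_list q X" "3 \<le> card (set q)" for q :: "'v list"
  proof -
    have "q \<noteq> []" using that(3) by auto
    then show ?thesis using that double by (intro avoidable_over_3_doubled) simp_all
  qed
  ultimately have "avoidable_over 3 p"
    using avoidable_over_reduction[of 2 3 p] assms(2) by simp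
  from avoidability_index_le[OF this] show "avoidability_index p \<le> 3" by (simp add: numeral_eq_enat)
next
  assume "length p \<ge> 3 * 2 ^ (k - 1)"
  then have "avoidable_over 2 p"
    using assms(2,3)
    by (intro avoidable_over_reduction[of 3 2 p] avoidable_over_2_two_variables avoidable_over_2_doubled) simp_all
  from avoidability_index_le[OF this] show "avoidability_index p = 2"
    using avoidability_index_ge_2[of p] by (simp add: numeral_eq_enat order.antisym)
qed

end
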